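(* Let $F\in\mathcal{T}^N_3$ satisfy $P^N(F)=\sup_{E\in\mathcal{T}^N_3}P^N(E)$, and suppose that the associated sequence of $F$ is $(1,n_2,n_3,n_4,1)$ with $n_3>1$. Then $\max\{n_2,n_4\}\le 2$.
   Context: A trunk graph with $N>0$ edges is a directed graph with vertices $v_1,\dots,v_n$ ($n\ge2$) such that every edge goes from some $v_i$ to $v_{i+1}$, there are $m_i\ge1$ edges from $v_i$ to $v_{i+1}$ for each $1\le i\le n-1$, and $m_1+\dots+m_{n-1}=N$. $\mathcal{T}^N_3$ is the set of trunk graphs with $N$ edges and all $m_i\le3$. $P^N(E)$ is the number of all finite directed paths in $E$, where vertices count as paths of length $0$. A trunk graph has associated sequence $(n_1,n_2,n_3,n_4,n_5)$ (with $n_j\ge0$) if $(m_1,\dots,m_{n-1})$ consists of $n_1$ ones, followed by $n_2$ twos, then $n_3$ threes, then $n_4$ twos, then $n_5$ ones. *)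

theory Defs
  imports Complex_Main "Graph_Theory.Arc_Walk"
begin

text \<open>
  Multigraphs are the \<open>pre_digraph\<close>s of Graph_Theory, which distinguish parallel arcs.
  The list \<open>vs\<close> is the sequence of vertices and \<open>ms\<close> the sequence of arc multiplicities; a positive
  cardinality in the last clause forces the corresponding set of parallel arcs to be finite.
\<close>

definition trunk_graph :: "('a, 'b) pre_digraph \<Rightarrow> nat list \<Rightarrow> bool" where
  "trunk_graph G ms \<longleftrightarrow>
     ms \<noteq> [] \<and> (\<forall>m \<in> set ms. 1 \<le> m) \<and>
     (\<exists>vs. distinct vs \<and> set vs = verts G \<and> length vs = Suc (length ms) \<and>
       (\<forall>e \<in> arcs G. \<exists>i < length ms. tail G e = vs ! i \<and> head G e = vs ! Suc i) \<and>
       (\<forall>i < length ms. card {e \<in> arcs G. tail G e = vs ! i \<and> head G e = vs ! Suc i} = ms ! i))"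

definition trunk_graphs3 :: "nat \<Rightarrow> ('a, 'b) pre_digraph set" where
  "trunk_graphs3 N =
     {G. \<exists>ms. trunk_graph G ms \<and> sum_list ms = N \<and> (\<forall>m \<in> set ms. m \<le> 3)}"

text \<open>
  A directed path is an arc walk together with its end points, so every vertex contributes one path of
  length 0. Finiteness of this set for trunk graphs is shown below.
\<close>

definition num_paths :: "('a, 'b) pre_digraph \<Rightarrow> nat" where
  "num_paths G = card {(u, p, v). pre_digraph.awalk G u p v}"

definition has_assoc_seq :: "('a, 'b) pre_digraph \<Rightarrow> nat \<times> nat \<times> nat \<times> nat \<times> nat \<Rightarrow> bool" where
  "has_assoc_seq G = (\<lambda>(n1, n2, n3, n4, n5).
     trunk_graph G
       (replicate n1 1 @ replicate n2 2 @ replicate n3 3 @ replicate n4 2 @ replicate n5 1))"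

text \<open>
  The remaining lemmas show that the conventions \<open>card A = 0\<close> for infinite \<open>A\<close> and \<open>Sup A = 0\<close> for
  unbounded \<open>A :: nat set\<close> play no role for trunk graphs with a given number of arcs.
\<close>

lemma trunk_graph_fin_digraph:
  assumes "trunk_graph G ms"
  shows "fin_digraph G" and "card (arcs G) \<le> sum_list ms" and "card (verts G) = Suc (length ms)"
proof -
  from assms obtain vs where vs: "distinct vs" "set vs = verts G" "length vs = Suc (length ms)"
    and e: "\<And>e. e \<in> arcs G \<Longrightarrow> \<exists>i < length ms. tail G e = vs ! i \<and> head G e = vs ! Suc i"
    and c: "\<And>i. i < length ms \<Longrightarrow>
      card {e \<in> arcs G. tail G e = vs ! i \<and> head G e = vs ! Suc i} = ms ! i"
    and pos: "\<forall>m \<in> set ms. 1 \<le> m"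
    unfolding trunk_graph_def by blast
  define A where "A i = {e \<in> arcs G. tail G e = vs ! i \<and> head G e = vs ! Suc i}" for i
  have arcs: "arcs G = (\<Union>i<length ms. A i)"
    using e unfolding A_def by blast
  have "finite (A i)" if "i < length ms" for i
  proof (rule card_ge_0_finite)
    show "0 < card (A i)"
      using c[OF that] pos nth_mem[OF that] unfolding A_def by force
  qed
  then have fin: "finite (arcs G)"
    unfolding arcs by blast
  have "tail G e \<in> verts G \<and> head G e \<in> verts G" if "e \<in> arcs G" for e
    using e[OF that] vs by (metis Suc_less_eq less_Suc_eq nth_mem)
  then show "fin_digraph G"
    using fin vs(2) List.finite_set[of vs] by unfold_locales auto
  have "card (arcs G) \<le> (\<Sum>i<length ms. card (A i))"
    unfolding arcs by (rule card_UN_le) simp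
  also have "\<dots> = sum_list ms"
    using c unfolding A_def by (simp add: sum_list_sum_nth atLeast0LessThan)
  finally show "card (arcs G) \<le> sum_list ms" .
  show "card (verts G) = Suc (length ms)"
    using vs distinct_card by metis
qed

lemma trunk_graph_awalk_length:
  assumes "trunk_graph G ms" and "pre_digraph.awalk G u p v"
  shows "length p \<le> length ms"
proof -
  from assms(1) obtain vs where vs: "distinct vs" "set vs = verts G" "length vs = Suc (length ms)"
    and e: "\<And>e. e \<in> arcs G \<Longrightarrow> \<exists>i < length ms. tail G e = vs ! i \<and> head G e = vs ! Suc i"
    unfolding trunk_graph_def by blast
  have step: "i + length p \<le> length ms"
    if "pre_digraph.cas G (vs ! i) p v" "set p \<subseteq> arcs G" "i \<le> length ms" for i
    using that
  proof (induction p arbitrary: i)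
    case Nil
    then show ?case by simp
  next
    case (Cons a p)
    then obtain j where j: "j < length ms" "tail G a = vs ! j" "head G a = vs ! Suc j"
      using e by force
    have "vs ! j = vs ! i" "pre_digraph.cas G (vs ! Suc j) p v"
      using Cons.prems(1) j by (simp_all add: pre_digraph.cas.simps)
    moreover from this have "j = i"
      using vs(1,3) j(1) Cons.prems(3) nth_eq_iff_index_eq[of vs j i] by simp
    ultimately show ?case
      using Cons.IH[of "Suc i"] Cons.prems(2) j(1) by simp
  qed
  have "u \<in> set vs" "pre_digraph.cas G u p v" "set p \<subseteq> arcs G"
    using assms(2) vs(2) by (simp_all add: pre_digraph.awalk_def)
  then show ?thesis
    using step vs(3) by (metis add_leD2 in_set_conv_nth less_Suc_eq_le)
qed

lemma trunk_graph_paths_bound: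
  assumes "trunk_graph G ms"
  defines "N \<equiv> sum_list ms"
  shows "finite {(u, p, v). pre_digraph.awalk G u p v}"
    and "num_paths G \<le> Suc N * ((\<Sum>i\<le>N. N ^ i) * Suc N)"
proof -
  interpret fin_digraph G
    using assms(1) by (rule trunk_graph_fin_digraph)
  have "1 \<le> m" if "m \<in> set ms" for m
    using assms(1) that unfolding trunk_graph_def by blast
  then have len: "length ms \<le> N"
    using sum_list_mono[of ms "\<lambda>_. 1" "\<lambda>m. m"] unfolding N_def by (simp add: sum_list_triv)
  define L where "L = {p. set p \<subseteq> arcs G \<and> length p \<le> N}"
  have finL: "finite L"
    unfolding L_def by (rule finite_lists_length_le) simp
  have sub: "{(u, p, v). awalk u p v} \<subseteq> verts G \<times> L \<times> verts G"
  proof -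
    have "u \<in> verts G \<and> p \<in> L \<and> v \<in> verts G" if "awalk u p v" for u p v
      using that trunk_graph_awalk_length[OF assms(1) that] len awalk_last_in_verts[OF that]
      unfolding L_def by (auto simp: awalk_def)
    then show ?thesis by auto
  qed
  then show "finite {(u, p, v). awalk u p v}"
    using finL by (meson finite_SigmaI finite_subset finite_verts)
  have "num_paths G \<le> card (verts G \<times> L \<times> verts G)"
    unfolding num_paths_def using sub finL by (intro card_mono) auto
  also have "\<dots> = card (verts G) * ((\<Sum>i\<le>N. card (arcs G) ^ i) * card (verts G))"
    unfolding L_def by (simp add: card_cartesian_product card_lists_length_le)
  also have "\<dots> \<le> Suc N * ((\<Sum>i\<le>N. N ^ i) * Suc N)"
    using trunk_graph_fin_digraph(2,3)[OF assms(1)] len unfolding N_def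
    by (intro mult_le_mono sum_mono power_mono) auto
  finally show "num_paths G \<le> Suc N * ((\<Sum>i\<le>N. N ^ i) * Suc N)" .
qed

lemma bdd_above_num_paths: "bdd_above (num_paths ` trunk_graphs3 N)"
  unfolding trunk_graphs3_def
  by (rule bdd_aboveI[of _ "Suc N * ((\<Sum>i\<le>N. N ^ i) * Suc N)"]) (use trunk_graph_paths_bound(2) in blast)

end

theory Submission
  imports Defs "HOL-Library.Nat_Bijection"
begin

text \<open>
  The number of paths is a function of the multiplicities alone. For the associated sequence
  \<open>(1, a, c, b, 1)\<close>, with \<open>x = 2^a\<close>, \<open>y = 2^b\<close> and \<open>t = 3^c\<close>, four times this number is
  \<open>36 x y t - 6 (t - 1) (x + y) - 4 (a + b) + t - 2 c - 13\<close>. At fixed \<open>a + b\<close> it grows as \<open>x + y\<close>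
  shrinks, so an optimal graph has \<open>\<bar>a - b\<bar> \<le> 1\<close>. If then \<open>max a b \<ge> 3\<close>, trading three of the
  twos for two threes, as evenly as possible, increases the number of paths when \<open>c \<ge> 2\<close>.
\<close>

section \<open>Path counts as a recursion on the multiplicities\<close>

text \<open>Counts the paths that start at the first vertex: the trivial one, or one of
  \<open>m\<close> arcs followed by a path from the next vertex.\<close>

primrec paths_from :: "nat list \<Rightarrow> nat" where
  "paths_from [] = 1"
| "paths_from (m # ms) = 1 + m * paths_from ms"

primrec path_total :: "nat list \<Rightarrow> nat" where
  "path_total [] = 1"
| "path_total (m # ms) = paths_from (m # ms) + path_total ms"

lemma path_total_eq_sum: "path_total ms = (\<Sum>i\<le>length ms. paths_from (drop i ms))"
proof (induction ms)
  case (Cons m ms)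
  then show ?case
    by (simp add: sum.atMost_Suc_shift del: sum.atMost_Suc paths_from.simps)
qed simp

text \<open>Distinct vertices make the classes of parallel arcs disjoint. Hence all multiplicity
  lists of one graph have the same sum.\<close>

lemma trunk_graph_card_arcs:
  assumes "trunk_graph G ms"
  shows "card (arcs G) = sum_list ms"
proof -
  interpret fin_digraph G
    using assms by (rule trunk_graph_fin_digraph)
  from assms obtain vs where vs: "distinct vs" "length vs = Suc (length ms)"
    and e: "\<And>e. e \<in> arcs G \<Longrightarrow> \<exists>i < length ms. tail G e = vs ! i \<and> head G e = vs ! Suc i"
    and c: "\<And>i. i < length ms \<Longrightarrow>
      card {e \<in> arcs G. tail G e = vs ! i \<and> head G e = vs ! Suc i} = ms ! i"
    unfolding trunk_graph_def by blast
  define A where "A i = {e \<in> arcs G. tail G e = vs ! i \<and> head G e = vs ! Suc i}" for i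
  have arcs: "arcs G = (\<Union>i<length ms. A i)"
    using e unfolding A_def by blast
  have disj: "A i \<inter> A j = {}" if "i < length ms" "j < length ms" "i \<noteq> j" for i j
    using that vs nth_eq_iff_index_eq[of vs i j] unfolding A_def by auto
  have fin: "finite (A i)" for i
    unfolding A_def by simp
  have "card (arcs G) = (\<Sum>i<length ms. card (A i))"
    unfolding arcs using disj fin by (intro card_UN_disjoint) simp_all
  also have "\<dots> = sum_list ms"
    using c unfolding A_def by (simp add: sum_list_sum_nth atLeast0LessThan)
  finally show ?thesis .
qed

text \<open>Paths are grouped by their start, and those from each vertex are counted backwards from
  the end of the trunk.\<close>

lemma trunk_graph_num_paths:
  assumes "trunk_graph G ms"
  shows "num_paths G = path_total ms"
proof -
  interpret fin_digraph G
    using assms by (rule trunk_graph_fin_digraph)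
  from assms obtain vs where vs: "distinct vs" "set vs = verts G" "length vs = Suc (length ms)"
    and e: "\<And>e. e \<in> arcs G \<Longrightarrow> \<exists>i < length ms. tail G e = vs ! i \<and> head G e = vs ! Suc i"
    and c: "\<And>i. i < length ms \<Longrightarrow>
      card {e \<in> arcs G. tail G e = vs ! i \<and> head G e = vs ! Suc i} = ms ! i"
    unfolding trunk_graph_def by blast
  define W where "W u = {p. \<exists>v. awalk u p v}" for u
  define A where "A i = {e \<in> arcs G. tail G e = vs ! i \<and> head G e = vs ! Suc i}" for i
  have vert: "vs ! i \<in> verts G" if "i \<le> length ms" for i
    using that vs(2,3) by (metis le_imp_less_Suc nth_mem)
  have finA: "finite (A i)" for i
    unfolding A_def by simp
  \<comment> \<open>Distinctness of \<open>vs\<close> lets the tail fix the position of an arc. For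
    \<open>i = length ms\<close> both sides are false, as no arc leaves the last vertex.\<close>
  have out: "tail G a = vs ! i \<longleftrightarrow> a \<in> A i" if "a \<in> arcs G" "i \<le> length ms" for a i
    using e[OF that(1)] that vs(1,3) nth_eq_iff_index_eq[of vs] unfolding A_def by fastforce
  have W: "finite (W (vs ! i)) \<and> card (W (vs ! i)) = paths_from (drop i ms)"
    if "i \<le> length ms" for i
    using that
  proof (induction rule: inc_induct)
    case base
    have "p = []" if "p \<in> W (vs ! length ms)" for p
    proof (cases p)
      case (Cons a q)
      then have "a \<in> arcs G" "tail G a = vs ! length ms"
        using that unfolding W_def by (auto simp: awalk_Cons_iff)
      then show ?thesis
        using e[of a] vs(1,3) nth_eq_iff_index_eq[of vs] by fastforce
    qed
    then have "W (vs ! length ms) = {[]}"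
      using vert[of "length ms"] unfolding W_def by (auto simp: awalk_Nil_iff)
    then show ?case
      by simp
  next
    case (step i)
    have "p \<in> W (vs ! i) \<longleftrightarrow> p \<in> insert [] ((\<lambda>(a, q). a # q) ` (A i \<times> W (vs ! Suc i)))" for p
    proof (cases p)
      case Nil
      then show ?thesis
        using vert[of i] step.hyps unfolding W_def by (auto simp: awalk_Nil_iff)
    next
      case (Cons a q)
      have "p \<in> W (vs ! i) \<longleftrightarrow> a \<in> arcs G \<and> tail G a = vs ! i \<and> q \<in> W (head G a)"
        unfolding W_def Cons by (auto simp: awalk_Cons_iff)
      also have "\<dots> \<longleftrightarrow> a \<in> A i \<and> q \<in> W (vs ! Suc i)"
        using out[of a i] step.hyps unfolding A_def by auto
      finally show ?thesis
        using Cons by auto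
    qed
    then have eq: "W (vs ! i) = insert [] ((\<lambda>(a, q). a # q) ` (A i \<times> W (vs ! Suc i)))"
      by blast
    have "card ((\<lambda>(a, q). a # q) ` (A i \<times> W (vs ! Suc i))) = ms ! i * paths_from (drop (Suc i) ms)"
      using c[OF step.hyps(2)] step.IH unfolding A_def
      by (subst card_image) (auto simp: inj_on_def card_cartesian_product)
    moreover have "[] \<notin> (\<lambda>(a, q). a # q) ` (A i \<times> W (vs ! Suc i))"
      by auto
    moreover have "drop i ms = ms ! i # drop (Suc i) ms"
      using step.hyps(2) by (simp add: Cons_nth_drop_Suc)
    ultimately show ?case
      unfolding eq using step.IH finA[of i] by simp
  qed
  \<comment> \<open>The start and the arc list determine the end point, even for the empty
    list.\<close>
  have "bij_betw (\<lambda>(u, p, v). (u, p)) {(u, p, v). awalk u p v} (SIGMA u:verts G. W u)"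
    by (rule bij_betw_byWitness[where f' = "\<lambda>(u, p). (u, p, awlast u p)"])
      (auto simp: W_def)
  then have "num_paths G = card (SIGMA u:verts G. W u)"
    unfolding num_paths_def by (rule bij_betw_same_card)
  also have "verts G = (!) vs ` {..length ms}"
    using vs(2,3) by (auto simp: set_conv_nth less_Suc_eq_le)
  also have "card (Sigma \<dots> W) = (\<Sum>u \<in> (!) vs ` {..length ms}. card (W u))"
    using W by (intro card_SigmaI) auto
  also have "\<dots> = (\<Sum>i\<le>length ms. card (W (vs ! i)))"
    using vs(1,3) by (subst sum.reindex) (auto simp: inj_on_def nth_eq_iff_index_eq)
  also have "\<dots> = path_total ms"
    unfolding path_total_eq_sum using W by simp
  finally show ?thesis .
qed

text \<open>Competitors must live on \<open>nat\<close>, so the \<open>j\<close>-th arc leaving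
  vertex \<open>i\<close> is coded as \<open>prod_encode (i, j)\<close>.\<close>

lemma trunk_graph_exists:
  assumes "ms \<noteq> []" and "\<forall>m \<in> set ms. 1 \<le> m"
  shows "\<exists>G :: (nat, nat) pre_digraph. trunk_graph G ms"
proof -
  define G where "G = \<lparr>verts = {..length ms},
    arcs = prod_encode ` (SIGMA i:{..<length ms}. {..<ms ! i}),
    tail = (\<lambda>e. fst (prod_decode e)), head = (\<lambda>e. Suc (fst (prod_decode e)))\<rparr>"
  let ?vs = "[0..<Suc (length ms)]"
  have nth: "?vs ! i = i" if "i \<le> length ms" for i
    using that by (simp del: upt_Suc)
  have "{e \<in> arcs G. tail G e = ?vs ! i \<and> head G e = ?vs ! Suc i} = (\<lambda>j. prod_encode (i, j)) ` {..<ms ! i}"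
    if "i < length ms" for i
    using that by (auto simp: G_def nth simp del: upt_Suc)
  then have "card {e \<in> arcs G. tail G e = ?vs ! i \<and> head G e = ?vs ! Suc i} = ms ! i"
    if "i < length ms" for i
    using that by (simp add: card_image inj_on_def del: upt_Suc)
  moreover have "\<exists>i < length ms. tail G e = ?vs ! i \<and> head G e = ?vs ! Suc i" if "e \<in> arcs G" for e
    using that by (auto simp: G_def nth simp del: upt_Suc)
  moreover have "set ?vs = verts G"
    by (auto simp: G_def)
  ultimately have "trunk_graph G ms"
    unfolding trunk_graph_def using assms by (intro conjI exI[of _ ?vs]) (simp_all del: upt_Suc)
  then show ?thesis ..
qed

section \<open>Closed forms for blocks of equal multiplicities\<close>

text \<open>Prepending a two sends \<open>p\<close> to \<open>1 + 2 * p\<close>, which doubles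
  \<open>p + 1\<close>; a three likewise triples \<open>2 * p + 1\<close>. Integers avoid truncated
  subtraction.\<close>

lemma paths_from_replicate_2:
  "int (paths_from (replicate n 2 @ ms)) = 2 ^ n * (int (paths_from ms) + 1) - 1"
  by (induction n) (simp_all add: algebra_simps)

lemma paths_from_replicate_3:
  "2 * int (paths_from (replicate n 3 @ ms)) = 3 ^ n * (2 * int (paths_from ms) + 1) - 1"
  by (induction n) (simp_all add: algebra_simps)

text \<open>A geometric sum of the preceding formula over the vertices of the block.\<close>

lemma path_total_replicate_2:
  "int (path_total (replicate n 2 @ ms)) =
     int (path_total ms) + 2 * (2 ^ n - 1) * (int (paths_from ms) + 1) - int n"
  by (induction n) (simp_all add: paths_from_replicate_2 algebra_simps)

lemma path_total_replicate_3:
  "4 * int (path_total (replicate n 3 @ ms)) =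
     4 * int (path_total ms) + 3 * (3 ^ n - 1) * (2 * int (paths_from ms) + 1) - 2 * int n"
proof (induction n)
  case (Suc n)
  then show ?case
    using paths_from_replicate_3[of n ms] by (simp add: algebra_simps)
qed simp

definition tower :: "nat \<Rightarrow> nat \<Rightarrow> nat \<Rightarrow> nat list" where
  "tower a c b = replicate 1 1 @ replicate a 2 @ replicate c 3 @ replicate b 2 @ replicate 1 1"

lemma path_total_tower:
  "4 * int (path_total (tower a c b)) =
     36 * 2 ^ a * 2 ^ b * 3 ^ c - 6 * (3 ^ c - 1) * (2 ^ a + 2 ^ b) - 4 * (int a + int b)
     + 3 ^ c - 2 * int c - 13"
proof -
  \<comment> \<open>Evaluation from the right: \<open>r\<close> is what follows the threes,
    \<open>m\<close> starts with them.\<close>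
  define r where "r = replicate b 2 @ [1::nat]"
  define m where "m = replicate c 3 @ r"
  have r: "int (paths_from r) = 3 * 2 ^ b - 1" "int (path_total r) = 6 * 2 ^ b - int b - 3"
    unfolding r_def paths_from_replicate_2 path_total_replicate_2 by simp_all
  have m: "2 * int (paths_from m) = 3 ^ c * (6 * 2 ^ b - 1) - 1"
    "4 * int (path_total m) = 24 * 2 ^ b - 4 * int b - 12 + 3 * (3 ^ c - 1) * (6 * 2 ^ b - 1) - 2 * int c"
    unfolding m_def paths_from_replicate_3 path_total_replicate_3 r by (simp_all add: algebra_simps)
  \<comment> \<open>The last summand counts the paths from the first vertex: the leading one adds 1
    and cancels the \<open>- 1\<close> of the block of twos.\<close>
  have "int (path_total (tower a c b)) =
      int (path_total m) + 2 * (2 ^ a - 1) * (int (paths_from m) + 1) - int a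
      + 2 ^ a * (int (paths_from m) + 1)"
    unfolding tower_def m_def[symmetric] r_def[symmetric]
    by (simp add: paths_from_replicate_2 path_total_replicate_2 m_def r_def)
  then have "4 * int (path_total (tower a c b)) =
      4 * int (path_total m) + (6 * 2 ^ a - 4) * (2 * int (paths_from m) + 2) - 4 * int a"
    by (simp add: algebra_simps)
  then show ?thesis
    unfolding m by (simp add: algebra_simps)
qed

section \<open>Moves that preserve the number of arcs\<close>

lemma path_total_tower_commute: "path_total (tower a c b) = path_total (tower b c a)"
proof -
  have "4 * int (path_total (tower a c b)) = 4 * int (path_total (tower b c a))"
    unfolding path_total_tower by (simp add: algebra_simps)
  then show ?thesis by simp
qed

text \<open>Moving a two across fixes \<open>2 ^ a * 2 ^ b\<close> and lowers
  \<open>2 ^ a + 2 ^ b\<close>, whose coefficient \<open>- 6 * (3 ^ c - 1)\<close> is negative for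
  \<open>c \<ge> 1\<close>.\<close>

lemma path_total_tower_balance:
  assumes "b + 2 \<le> a" and "c \<ge> 1"
  shows "path_total (tower a c b) < path_total (tower (a - 1) c (b + 1))"
proof -
  obtain k where a: "a = b + 2 + k"
    using assms(1) le_Suc_ex by blast
  define x y :: int where "x = 2 ^ k" and "y = 2 ^ b"
  define t :: int where "t = 3 ^ c"
  have "x \<ge> 1" "y \<ge> 1"
    unfolding x_def y_def by simp_all
  have "t \<ge> 3"
    using power_increasing[OF assms(2), of "3::int"] unfolding t_def by simp
  have pos: "(t - 1) * (y * (2 * x - 1)) > 0"
    using \<open>x \<ge> 1\<close> \<open>y \<ge> 1\<close> \<open>t \<ge> 3\<close> by simp
  have "4 * int (path_total (tower (a - 1) c (b + 1))) - 4 * int (path_total (tower a c b))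
      = 6 * ((t - 1) * (y * (2 * x - 1)))"
    unfolding path_total_tower a t_def x_def y_def by (simp add: algebra_simps power_add)
  with pos show ?thesis by linarith
qed

text \<open>Trading three twos for two threes multiplies the leading term by 9/8.\<close>

lemma path_total_tower_even:
  assumes "a \<ge> 3" and "c \<ge> 1"
  shows "path_total (tower a c a) < path_total (tower (a - 1) (c + 2) (a - 2))"
proof -
  obtain k where a: "a = 3 + k"
    using assms(1) le_Suc_ex by blast
  define u t :: int where "u = 2 ^ k" and "t = 3 ^ c"
  have "u \<ge> 1"
    unfolding u_def by simp
  have "t \<ge> 3"
    using power_increasing[OF assms(2), of "3::int"] unfolding t_def by simp
  \<comment> \<open>The difference is grouped into terms that are nonnegative for
    \<open>u \<ge> 1\<close>.\<close>
  have "4 * int (path_total (tower (a - 1) (c + 2) (a - 2))) - 4 * int (path_total (tower a c a))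
      = 228 * ((u * (u - 1)) * t) + 60 * (u * (u * t - 1)) + 8 * t + 8"
    unfolding path_total_tower a u_def t_def by (simp add: algebra_simps power_add)
  moreover have "(u * (u - 1)) * t \<ge> 0" "u * t \<ge> 1 * 1"
    using \<open>u \<ge> 1\<close> \<open>t \<ge> 3\<close> by (simp, intro mult_mono) auto
  moreover from this have "u * (u * t - 1) \<ge> 0"
    using \<open>u \<ge> 1\<close> by simp
  ultimately show ?thesis
    using \<open>t \<ge> 3\<close> by linarith
qed

text \<open>For \<open>c = 1\<close> the move fails: \<open>tower 3 1 2\<close> has more paths than \<open>tower 1 3 1\<close>.\<close>

lemma path_total_tower_odd:
  assumes "a \<ge> 3" and "c \<ge> 2"
  shows "path_total (tower a c (a - 1)) < path_total (tower (a - 2) (c + 2) (a - 2))"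
proof -
  obtain k where a: "a = 3 + k"
    using assms(1) le_Suc_ex by blast
  define u t :: int where "u = 2 ^ k" and "t = 3 ^ c"
  have "u \<ge> 1"
    unfolding u_def by simp
  have "t \<ge> 9"
    using power_increasing[OF assms(2), of "3::int"] unfolding t_def by simp
  \<comment> \<open>At \<open>u = 1\<close>, that is \<open>a = 3\<close>, only
    \<open>8 * t - 40\<close> remains: positive for \<open>t \<ge> 9\<close>, negative for
    \<open>t = 3\<close>.\<close>
  have "4 * int (path_total (tower (a - 2) (c + 2) (a - 2))) - 4 * int (path_total (tower a c (a - 1)))
      = 48 * ((u - 1) * (3 * (u * t) - 1)) + 8 * t - 40"
    unfolding path_total_tower a u_def t_def by (simp add: algebra_simps power_add)
  moreover have "u * t \<ge> 1 * 1"
    using \<open>u \<ge> 1\<close> \<open>t \<ge> 9\<close> by (intro mult_mono) auto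
  moreover from this have "(u - 1) * (3 * (u * t) - 1) \<ge> 0"
    using \<open>u \<ge> 1\<close> by simp
  ultimately show ?thesis
    using \<open>t \<ge> 9\<close> by linarith
qed

lemma path_total_tower_improve:
  assumes "a \<ge> 3" and "b \<le> a" and "c \<ge> 2"
  shows "\<exists>a' b' c'. sum_list (tower a' c' b') = sum_list (tower a c b) \<and>
    path_total (tower a c b) < path_total (tower a' c' b')"
proof -
  consider "b + 2 \<le> a" | "b = a" | "b = a - 1"
    using assms(2) by linarith
  then show ?thesis
  proof cases
    case 1
    have "sum_list (tower (a - 1) c (b + 1)) = sum_list (tower a c b)"
      using 1 by (simp add: tower_def sum_list_replicate)
    then show ?thesis
      using path_total_tower_balance[OF 1] assms(3) by (metis le_trans one_le_numeral)
  next
    case 2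
    have "sum_list (tower (a - 1) (c + 2) (a - 2)) = sum_list (tower a c b)"
      using 2 assms(1) by (simp add: tower_def sum_list_replicate)
    then show ?thesis
      using path_total_tower_even[of a c] assms 2 by (metis le_trans one_le_numeral)
  next
    case 3
    have "sum_list (tower (a - 2) (c + 2) (a - 2)) = sum_list (tower a c b)"
      using 3 assms(1) by (simp add: tower_def sum_list_replicate)
    then show ?thesis
      using path_total_tower_odd[of a c] assms 3 by metis
  qed
qed

(* The supremum is taken over graphs with vertices and arcs in nat, among which every finite
   multigraph occurs up to isomorphism; F itself may live on arbitrary types. *)
theorem theorem3p13:
  fixes F :: "('a, 'b) pre_digraph" and N n2 n3 n4 :: nat
  assumes "N > 0"
    and "F \<in> trunk_graphs3 N"
    and "num_paths F = (SUP E \<in> (trunk_graphs3 N :: (nat, nat) pre_digraph set). num_paths E)"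
    and "has_assoc_seq F (1, n2, n3, n4, 1)"
    and "n3 > 1"
  shows "max n2 n4 \<le> 2"
proof (rule ccontr)
  assume not: "\<not> max n2 n4 \<le> 2"
  have F: "trunk_graph F (tower n2 n3 n4)"
    using assms(4) unfolding has_assoc_seq_def tower_def by simp
  \<comment> \<open>Membership only yields some list \<open>ms\<close>; the arc count transfers its
    sum to the tower.\<close>
  obtain ms where "trunk_graph F ms" "sum_list ms = N"
    using assms(2) unfolding trunk_graphs3_def by blast
  then have N: "sum_list (tower n2 n3 n4) = N"
    using trunk_graph_card_arcs[OF F] trunk_graph_card_arcs[of F ms] by simp
  have max: "path_total (tower a c b) \<le> path_total (tower n2 n3 n4)"
    if "sum_list (tower a c b) = N" for a b c
  proof -
    have "tower a c b \<noteq> []" "\<forall>m \<in> set (tower a c b). 1 \<le> m" "\<forall>m \<in> set (tower a c b). m \<le> 3"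
      unfolding tower_def by auto
    then obtain G :: "(nat, nat) pre_digraph" where G: "trunk_graph G (tower a c b)"
      using trunk_graph_exists by blast
    then have "G \<in> trunk_graphs3 N"
      using that \<open>\<forall>m \<in> set (tower a c b). m \<le> 3\<close> unfolding trunk_graphs3_def by blast
    then have "num_paths G \<le> num_paths F"
      \<comment> \<open>The supremum on \<open>nat\<close> is an upper bound only for a bounded set
        of path counts.\<close>
      unfolding assms(3) by (rule cSUP_upper) (rule bdd_above_num_paths)
    then show ?thesis
      using trunk_graph_num_paths[OF G] trunk_graph_num_paths[OF F] by simp
  qed
  have swap: "sum_list (tower n4 n3 n2) = N"
    using N by (simp add: tower_def sum_list_replicate)
  have "n3 \<ge> 2"
    using assms(5) by simp
  show False
  proof (cases "n4 \<le> n2")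
    case True
    then show False
      using path_total_tower_improve[of n2 n4 n3] not \<open>n3 \<ge> 2\<close> max N by (fastforce simp: max_def)
  next
    \<comment> \<open>The mirrored tower has the same path count, so the longer block of twos can be
      put first.\<close>
    case False
    then obtain a b c where "sum_list (tower a c b) = N"
      "path_total (tower n4 n3 n2) < path_total (tower a c b)"
      using path_total_tower_improve[of n4 n2 n3] not \<open>n3 \<ge> 2\<close> swap by (auto simp: max_def)
    then show False
      using max[of a c b] path_total_tower_commute[of n4 n3 n2] by simp
  qed
qed

end
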